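(* Let $\mathscr{A}$ be a $C^*$-algebra, let $\mathscr{X}$ be a Hilbert $\mathscr{A}$-module, and let $x,y\in\mathscr{X}$. Then \[ \rho_{+}(x,y)=\max\Big\{\operatorname{Re}\varphi(\langle x,y\rangle):\ \varphi\in\Omega_x\Big\}, \] and in particular the supremum over $\Omega_x$ is attained.
   Context: A Hilbert $\mathscr{A}$-module is a right $\mathscr{A}$-module $\mathscr{X}$ with an $\mathscr{A}$-valued inner product $\langle\cdot,\cdot\rangle$, linear in the second variable and conjugate-linear in the first, with $\langle x,ya\rangle=\langle x,y\rangle a$, $\langle x,y\rangle^*=\langle y,x\rangle$, $\langle x,x\rangle\ge 0$ with equality iff $x=0$, complete for the norm $\|x\|=\|\langle x,x\rangle\|^{1/2}$. A state on $\mathscr{A}$ is a positive linear functional of norm one; $\mathcal{S}(\mathscr{A})$ denotes the set of states. For $x\in\mathscr{X}$, $\Omega_x:=\{\varphi\in\mathcal{S}(\mathscr{A}):\varphi(\langle x,x\rangle)=\|x\|^2\}$ (this set is nonempty). For a normed space $X$ and $x,y\in X$, the norm derivatives are $\rho_{\pm}(x,y):=\lim_{t\to0^{\pm}}\frac{\|x+ty\|^2-\|x\|^2}{2t}$. *)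

theory Defs
  imports "HOL-Analysis.Analysis"
begin

definition complex_scalar :: "(complex \<Rightarrow> 'v::real_normed_vector \<Rightarrow> 'v) \<Rightarrow> bool" where
  "complex_scalar sm \<longleftrightarrow>
     (\<forall>r v. sm (complex_of_real r) v = r *\<^sub>R v) \<and>
     (\<forall>c d v. sm (c * d) v = sm c (sm d v)) \<and>
     (\<forall>c v w. sm c (v + w) = sm c v + sm c w) \<and>
     (\<forall>c d v. sm (c + d) v = sm c v + sm d v)"

definition cstar_algebra ::
  "(complex \<Rightarrow> 'a::{real_normed_algebra,banach} \<Rightarrow> 'a) \<Rightarrow> ('a \<Rightarrow> 'a) \<Rightarrow> bool" where
  "cstar_algebra sm star \<longleftrightarrow>
     complex_scalar sm \<and>
     (\<forall>c a. norm (sm c a) = cmod c * norm a) \<and>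
     (\<forall>c a b. sm c (a * b) = sm c a * b \<and> sm c (a * b) = a * sm c b) \<and>
     (\<forall>a b. star (a + b) = star a + star b) \<and>
     (\<forall>c a. star (sm c a) = sm (cnj c) (star a)) \<and>
     (\<forall>a. star (star a) = a) \<and>
     (\<forall>a b. star (a * b) = star b * star a) \<and>
     (\<forall>a. norm (star a * a) = (norm a)\<^sup>2)"

text \<open>Positive elements of a C*-algebra (equivalently: self-adjoint with nonnegative
spectrum): the elements of the form b* b.\<close>
definition cstar_positive :: "('a::real_normed_algebra \<Rightarrow> 'a) \<Rightarrow> 'a \<Rightarrow> bool" where
  "cstar_positive star a \<longleftrightarrow> (\<exists>b. a = star b * b)"

definition hilbert_module ::
  "(complex \<Rightarrow> 'a::{real_normed_algebra,banach} \<Rightarrow> 'a) \<Rightarrow> ('a \<Rightarrow> 'a) \<Rightarrow>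
   (complex \<Rightarrow> 'x::banach \<Rightarrow> 'x) \<Rightarrow> ('x \<Rightarrow> 'a \<Rightarrow> 'x) \<Rightarrow> ('x \<Rightarrow> 'x \<Rightarrow> 'a) \<Rightarrow> bool" where
  "hilbert_module sm star smx act ip \<longleftrightarrow>
     cstar_algebra sm star \<and>
     complex_scalar smx \<and>
     (\<forall>x y a. act (x + y) a = act x a + act y a) \<and>
     (\<forall>x a b. act x (a + b) = act x a + act x b) \<and>
     (\<forall>x a b. act x (a * b) = act (act x a) b) \<and>
     (\<forall>c x a. smx c (act x a) = act (smx c x) a \<and> smx c (act x a) = act x (sm c a)) \<and>
     (\<forall>x y z. ip x (y + z) = ip x y + ip x z) \<and>
     (\<forall>c x y. ip x (smx c y) = sm c (ip x y)) \<and>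
     (\<forall>x y a. ip x (act y a) = ip x y * a) \<and>
     (\<forall>x y. star (ip x y) = ip y x) \<and>
     (\<forall>x. cstar_positive star (ip x x)) \<and>
     (\<forall>x. ip x x = 0 \<longleftrightarrow> x = 0) \<and>
     (\<forall>x. norm x = sqrt (norm (ip x x)))"

definition states ::
  "(complex \<Rightarrow> 'a::{real_normed_algebra,banach} \<Rightarrow> 'a) \<Rightarrow> ('a \<Rightarrow> 'a) \<Rightarrow> ('a \<Rightarrow> complex) set" where
  "states sm star = {\<phi>.
     (\<forall>a b. \<phi> (a + b) = \<phi> a + \<phi> b) \<and>
     (\<forall>c a. \<phi> (sm c a) = c * \<phi> a) \<and>
     (\<forall>a. cstar_positive star a \<longrightarrow> Im (\<phi> a) = 0 \<and> Re (\<phi> a) \<ge> 0) \<and>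
     bounded_linear \<phi> \<and> onorm \<phi> = 1}"

definition Omega ::
  "(complex \<Rightarrow> 'a::{real_normed_algebra,banach} \<Rightarrow> 'a) \<Rightarrow> ('a \<Rightarrow> 'a) \<Rightarrow>
   ('x::banach \<Rightarrow> 'x \<Rightarrow> 'a) \<Rightarrow> 'x \<Rightarrow> ('a \<Rightarrow> complex) set" where
  "Omega sm star ip x = {\<phi> \<in> states sm star. \<phi> (ip x x) = complex_of_real ((norm x)\<^sup>2)}"

end

theory Submission
  imports Defs
begin

text \<open>The right derivative at a = <x,x> of the norm of the C*-algebra, v \<mapsto>
  lim (\<parallel>a + t v\<parallel> - \<parallel>a\<parallel>) / t, is a sublinear functional below the norm, equal to \<plusminus>\<parallel>a\<parallel> at \<plusminus>a. By
  Hahn-Banach it dominates a linear f agreeing with it at b = <x,y> + <y,x>, and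
  f a = \<parallel>a\<parallel>. Expanding <x+ty,x+ty> = a + t b + O(t^2) shows that the limit in question is f b / 2.

  Such an f is automatically positive, because two positive elements a, c of norm at most s satisfy
  \<parallel>a - c\<parallel> \<le> s: for c scaled to norm at most \<parallel>a\<parallel> this gives f a - f c \<le> \<parallel>a\<parallel> = f a. The norm bound needs
  positivity of all elements d* d (Kaplansky's theorem), proved here without spectral theory in the
  unital algebra of adjointable operators on the C*-algebra, where 1 - x has a square root for
  self-adjoint x of norm at most 1 and the squares of self-adjoint elements form a cone.\<close>

section \<open>Square roots and positivity in algebras of adjointable operators\<close>

typedef (overloaded) 'a endo = "UNIV :: ('a::real_normed_vector \<Rightarrow>\<^sub>L 'a) set"
  morphisms operator Endo ..

setup_lifting type_definition_endo

text \<open>The class is \<open>monoid_mult\<close> with no demand that 1 have norm one, because on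
  the zero space the identity operator is 0.\<close>

instantiation endo :: (real_normed_vector) "{real_normed_algebra,monoid_mult}"
begin

lift_definition zero_endo :: "'a endo" is 0 .
lift_definition one_endo :: "'a endo" is id_blinfun .
lift_definition plus_endo :: "'a endo \<Rightarrow> 'a endo \<Rightarrow> 'a endo" is plus .
lift_definition minus_endo :: "'a endo \<Rightarrow> 'a endo \<Rightarrow> 'a endo" is minus .
lift_definition uminus_endo :: "'a endo \<Rightarrow> 'a endo" is uminus .
lift_definition times_endo :: "'a endo \<Rightarrow> 'a endo \<Rightarrow> 'a endo" is blinfun_compose .
lift_definition scaleR_endo :: "real \<Rightarrow> 'a endo \<Rightarrow> 'a endo" is scaleR .
lift_definition norm_endo :: "'a endo \<Rightarrow> real" is norm .
definition dist_endo :: "'a endo \<Rightarrow> 'a endo \<Rightarrow> real"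
  where "dist_endo S T = norm (S - T)"
definition sgn_endo :: "'a endo \<Rightarrow> 'a endo"
  where "sgn_endo S = inverse (norm S) *\<^sub>R S"
definition uniformity_endo :: "('a endo \<times> 'a endo) filter"
  where "uniformity_endo = (INF e\<in>{0 <..}. principal {(S, T). dist S T < e})"
definition open_endo :: "'a endo set \<Rightarrow> bool"
  where "open_endo U \<longleftrightarrow> (\<forall>S\<in>U. \<forall>\<^sub>F (S', T) in uniformity. S' = S \<longrightarrow> T \<in> U)"

instance
proof
  fix S T U :: "'a endo" and r s :: real
  show "dist S T = norm (S - T)" "sgn S = inverse (norm S) *\<^sub>R S"
    "uniformity = (INF e\<in>{0 <..}. principal {(S::'a endo, T). dist S T < e})"
    by (simp_all add: dist_endo_def sgn_endo_def uniformity_endo_def)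
  show "open V \<longleftrightarrow> (\<forall>S\<in>V. \<forall>\<^sub>F (S', T) in uniformity. S' = S \<longrightarrow> T \<in> V)" for V :: "'a endo set"
    by (simp add: open_endo_def)
qed (transfer, auto intro: blinfun_eqI norm_triangle_ineq norm_blinfun_compose
      simp: algebra_simps blinfun.bilinear_simps)+

end

lemma operator_simps [simp]:
  "operator (S + T) x = operator S x + operator T x"
  "operator (S - T) x = operator S x - operator T x"
  "operator (- S) x = - operator S x"
  "operator (S * T) x = operator S (operator T x)"
  "operator (r *\<^sub>R S) x = r *\<^sub>R operator S x"
  "operator 0 x = 0"
  "operator 1 x = x"
  by (transfer; simp add: blinfun.bilinear_simps)+

lemma endo_eqI: "(\<And>x. operator S x = operator T x) \<Longrightarrow> S = T"
  by transfer (rule blinfun_eqI)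

lemma norm_operator: "norm (operator S x) \<le> norm S * norm x"
  by transfer (rule norm_blinfun)

lemma norm_endo_bound: "0 \<le> b \<Longrightarrow> (\<And>x. norm (operator S x) \<le> b * norm x) \<Longrightarrow> norm S \<le> b"
  by transfer (rule norm_blinfun_bound)

instance endo :: (banach) banach
proof
  fix X :: "nat \<Rightarrow> 'a endo"
  assume X: "Cauchy X"
  have norm_eq: "norm (operator S - operator T) = norm (S - T)" for S T :: "'a endo"
    by transfer simp
  have "Cauchy (\<lambda>n. operator (X n))"
    using X by (simp add: Cauchy_def dist_norm norm_eq)
  then obtain L where "(\<lambda>n. operator (X n)) \<longlonglongrightarrow> L"
    using Cauchy_convergent convergent_def by blast
  then have "(\<lambda>n. operator (X n)) \<longlonglongrightarrow> operator (Endo L)"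
    by (simp add: Endo_inverse)
  then have "X \<longlonglongrightarrow> Endo L"
    by (simp add: LIMSEQ_iff norm_eq)
  then show "convergent X"
    by (auto simp: convergent_def)
qed

section \<open>Algebras with an adjoint relation\<close>

lemma commute_left: "a * b = b * a \<Longrightarrow> a * (b * c) = b * (a * c)" for a b c :: "'a::semigroup_mult"
  by (simp flip: mult.assoc)

text \<open>Here J plays the role of the imaginary unit.\<close>
locale adjoint_algebra =
  fixes adj :: "'b::{real_normed_algebra,banach,monoid_mult} \<Rightarrow> 'b \<Rightarrow> bool"
    and J :: 'b
  assumes adj_sym: "adj S T \<Longrightarrow> adj T S"
    and adj_add: "adj S T \<Longrightarrow> adj S' T' \<Longrightarrow> adj (S + S') (T + T')"
    and adj_mult: "adj S T \<Longrightarrow> adj S' T' \<Longrightarrow> adj (S * S') (T' * T)"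
    and adj_scaleR: "adj S T \<Longrightarrow> adj (r *\<^sub>R S) (r *\<^sub>R T)"
    and adj_one: "adj 1 1"
    and norm_adj_mult: "adj S T \<Longrightarrow> (norm S)\<^sup>2 \<le> norm (T * S)"
    and adj_limit: "(\<And>n. adj (X n) (X n)) \<Longrightarrow> X \<longlonglongrightarrow> L \<Longrightarrow> adj L L"
    and adj_J: "adj J (- J)"
    and J_square: "J * J = - 1"
    and J_commute: "adj S T \<Longrightarrow> S * J = J * S"
begin

abbreviation sa :: "'b \<Rightarrow> bool" where "sa S \<equiv> adj S S"

text \<open>Squares rather than all products \<open>T' * T\<close>: sums of squares yield to norm
  estimates alone, and \<open>pos_adj_mult\<close> shows afterwards that these products are squares
  too.\<close>

definition pos :: "'b \<Rightarrow> bool" where "pos K \<longleftrightarrow> (\<exists>S. sa S \<and> K = S * S)"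

lemma adj_minus: "adj S T \<Longrightarrow> adj (- S) (- T)"
  using adj_scaleR[of S T "-1"] by simp

lemma adj_diff: "adj S T \<Longrightarrow> adj S' T' \<Longrightarrow> adj (S - S') (T - T')"
  using adj_add[OF _ adj_minus, of S T S' T'] by simp

lemma sa_mult: "sa S \<Longrightarrow> sa T \<Longrightarrow> S * T = T * S \<Longrightarrow> sa (S * T)"
  using adj_mult[of S S T T] by simp

lemma norm_one_le: "norm (1::'b) \<le> 1"
  using norm_adj_mult[OF adj_one] by (cases "(1::'b) = 0") (simp_all add: power2_eq_square)

lemma norm_le_adj: assumes "adj S T" shows "norm S \<le> norm T"
proof -
  have "norm S * norm S \<le> norm T * norm S"
    using norm_adj_mult[OF assms] norm_mult_ineq[of T S] by (simp add: power2_eq_square)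
  then show ?thesis
    by (cases "S = 0") simp_all
qed

lemma sa_square_eq_0: "sa S \<Longrightarrow> S * S = 0 \<Longrightarrow> S = 0"
  using norm_adj_mult[of S S] by simp

section \<open>Square roots of 1 - X\<close>

lemma sqrt_one_minus:
  assumes "sa X" "norm X \<le> 1"
  obtains Q where "sa Q" "Q * Q = 1 - X" "norm (1 - Q) \<le> 1"
    "\<And>Z. Z * X = X * Z \<Longrightarrow> Z * Q = Q * Z"
proof -
  \<comment> \<open>Fixed points Y of this iteration satisfy (1 - Y) * (1 - Y) = 1 - X. The scalar iteration y
    for X = 1 dominates the increments, which gives convergence also when X has norm 1.\<close>
  define Y where "Y = rec_nat 0 (\<lambda>_ Y. (1/2) *\<^sub>R (X + Y * Y))"
  define y :: "nat \<Rightarrow> real" where "y = rec_nat 0 (\<lambda>_ y. (1 + y * y) / 2)"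
  have Y0: "Y 0 = 0" and YS: "Y (Suc n) = (1/2) *\<^sub>R (X + Y n * Y n)" for n
    by (simp_all add: Y_def)
  have y0: "y 0 = 0" and yS: "y (Suc n) = (1 + y n * y n) / 2" for n
    by (simp_all add: y_def)
  have y_bounds: "0 \<le> y n \<and> y n \<le> 1" for n
    by (induction n) (auto simp: y0 yS mult_le_one)
  have sa_Y: "sa (Y n)" for n
    using assms(1) adj_scaleR[OF adj_one, of 0] by (induction n) (auto simp: Y0 YS intro: adj_scaleR adj_add sa_mult)
  have comm: "Z * Y n = Y n * Z" if "Z * X = X * Z" for Z n
  proof (induction n)
    case (Suc n)
    have "Z * (Y n * Y n) = Y n * Y n * Z"
      by (simp add: Suc commute_left[OF Suc] mult.assoc)
    then show ?case
      by (simp add: YS distrib_left distrib_right that)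
  qed (simp add: Y0)
  \<comment> \<open>X commutes with itself, hence with each Y m; so Y m commutes with X and
    therefore with every Y n.\<close>
  have YY: "Y m * Y n = Y n * Y m" for m n
    by (rule comm, rule comm[symmetric]) simp
  have norm_Y: "norm (Y n) \<le> y n" for n
  proof (induction n)
    case (Suc n)
    have "norm (Y n * Y n) \<le> y n * y n"
      by (rule order_trans[OF norm_mult_ineq]) (use Suc y_bounds in \<open>auto intro: mult_mono\<close>)
    then show ?case
      using norm_triangle_ineq[of X "Y n * Y n"] assms(2) by (simp add: YS yS)
  qed (simp add: Y0 y0)
  have step: "norm (Y (Suc n) - Y n) \<le> y (Suc n) - y n" for n
  proof (induction n)
    case (Suc n)
    \<comment> \<open>The terms X cancel, and the difference of two squares factors because the
      iterates commute.\<close>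
    have eq: "Y (Suc (Suc n)) - Y (Suc n) = (1/2) *\<^sub>R ((Y (Suc n) + Y n) * (Y (Suc n) - Y n))"
      unfolding YS[of "Suc n"] YS[of n, THEN arg_cong, of "\<lambda>u. _ - u"]
      using YY[of n "Suc n"] by (simp add: algebra_simps)
    have "norm ((Y (Suc n) + Y n) * (Y (Suc n) - Y n)) \<le> (y (Suc n) + y n) * (y (Suc n) - y n)"
      by (rule order_trans[OF norm_mult_ineq], rule mult_mono)
        (use Suc y_bounds norm_Y in \<open>auto intro: order_trans[OF norm_triangle_ineq] add_mono\<close>)
    also have "\<dots> = 2 * (y (Suc (Suc n)) - y (Suc n))"
      unfolding yS[of "Suc n"] yS[of n, THEN arg_cong, of "\<lambda>u. _ - u"] by (simp add: algebra_simps)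
    finally show ?case
      by (simp add: eq)
  qed (use norm_Y[of "Suc 0"] in \<open>simp add: Y0 y0\<close>)
  have inc: "incseq y"
  proof (rule incseq_SucI)
    show "y n \<le> y (Suc n)" for n
      using step[of n] norm_ge_zero[of "Y (Suc n) - Y n"] by linarith
  qed
  note Y_step = step
  have steps: "norm (Y n - Y m) \<le> y n - y m" if "m \<le> n" for m n
    using that
  proof (induction n rule: dec_induct)
    case (step n)
    then show ?case
      using norm_triangle_ineq[of "Y (Suc n) - Y n" "Y n - Y m"] Y_step[of n] by simp
  qed simp
  have "Cauchy y"
  proof -
    obtain l where "y \<longlonglongrightarrow> l"
      by (rule incseq_convergent[OF inc, of 1]) (use y_bounds in auto)
    then show ?thesis
      by (rule LIMSEQ_imp_Cauchy)
  qed
  have "Cauchy Y"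
  proof (rule CauchyI')
    fix e :: real assume "0 < e"
    from CauchyD[OF \<open>Cauchy y\<close> this]
    obtain M where M: "\<forall>m\<ge>M. \<forall>n\<ge>M. norm (y m - y n) < e"
      by blast
    have "dist (Y m) (Y n) < e" if "m \<ge> M" "n > m" for m n
    proof -
      have "norm (y n - y m) < e"
        using M that by (meson less_imp_le order_trans)
      then show ?thesis
        using steps[of m n] that by (simp add: dist_norm norm_minus_commute)
    qed
    then show "\<exists>M. \<forall>m\<ge>M. \<forall>n>m. dist (Y m) (Y n) < e" by blast
  qed
  then obtain L where L: "Y \<longlonglongrightarrow> L"
    using Cauchy_convergent convergent_def by blast
  have "(\<lambda>n. (1/2) *\<^sub>R (X + Y n * Y n)) \<longlonglongrightarrow> (1/2) *\<^sub>R (X + L * L)"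
    by (intro tendsto_intros L)
  moreover have "(\<lambda>n. Y (Suc n)) \<longlonglongrightarrow> L"
    using L by (rule LIMSEQ_Suc)
  ultimately have fix_L: "L = (1/2) *\<^sub>R (X + L * L)"
    unfolding YS by (metis LIMSEQ_unique)
  have "X = 2 *\<^sub>R ((1/2) *\<^sub>R (X + L * L)) - L * L"
    by simp
  also have "\<dots> = 2 *\<^sub>R L - L * L"
    by (simp only: fix_L[symmetric])
  finally have X: "X = 2 *\<^sub>R L - L * L" .
  have sq: "(1 - L) * (1 - L) = 1 - X"
    unfolding X by (simp add: left_diff_distrib right_diff_distrib scaleR_2)
  \<comment> \<open>The root is Q = 1 - L, so this bounds 1 - Q. By
    \<open>pos_if_norm_diff_le\<close> it makes Q itself positive, which \<open>sa_abs\<close>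
    uses.\<close>
  have norm_L: "norm L \<le> 1"
  proof (rule LIMSEQ_le_const2[OF tendsto_norm[OF L]])
    show "\<exists>N. \<forall>n\<ge>N. norm (Y n) \<le> 1"
      using norm_Y y_bounds order_trans by blast
  qed
  have sa_L: "sa L"
    by (rule adj_limit[OF sa_Y L])
  have comm_L: "Z * (1 - L) = (1 - L) * Z" if "Z * X = X * Z" for Z
  proof -
    have "(\<lambda>n. Z * Y n) \<longlonglongrightarrow> Z * L" "(\<lambda>n. Z * Y n) \<longlonglongrightarrow> L * Z"
      using tendsto_mult_left[OF L, of Z] tendsto_mult_right[OF L, of Z] by (simp_all add: comm[OF that])
    then have "Z * L = L * Z"
      by (rule LIMSEQ_unique)
    then show ?thesis
      by (simp add: left_diff_distrib right_diff_distrib)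
  qed
  show ?thesis
    by (rule that[OF adj_diff[OF adj_one sa_L] sq _ comm_L]) (simp add: norm_L)
qed

lemma norm_le_one_of_squares:
  assumes S: "sa S" and Q: "sa Q" and SQ: "S * Q = Q * S" and one: "S * S + Q * Q = 1"
  shows "norm S \<le> 1"
proof -
  \<comment> \<open>T is unitary with real part S.\<close>
  let ?T = "S + J * Q" and ?T' = "S - J * Q"
  have "adj (J * Q) (- (J * Q))"
    using adj_mult[OF adj_J Q] J_commute[OF Q] by simp
  from adj_add[OF S this] have T: "adj ?T ?T'"
    by simp
  have J': "Z * (J * W) = J * (Z * W)" if "sa Z" for Z W
    by (simp add: J_commute[OF that] flip: mult.assoc)
  have "J * (J * W) = - W" for W
    by (simp add: J_square flip: mult.assoc)
  then have "?T' * ?T = S * S + Q * Q"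
    by (simp add: distrib_left left_diff_distrib mult.assoc J'[OF S] J'[OF Q] SQ)
  then have "norm ?T \<le> 1"
    using norm_adj_mult[OF T] norm_one_le one by (smt (verit) norm_ge_zero power2_le_imp_le power_one)
  moreover have "norm ?T' \<le> norm ?T"
    using T adj_sym norm_le_adj by blast
  moreover have "2 * norm S = norm (?T + ?T')"
    by (simp flip: scaleR_2)
  ultimately show ?thesis
    using norm_triangle_ineq[of ?T ?T'] by linarith
qed

text \<open>A root Q of 1 - S^2 commutes with S and S^2 + Q^2 = 1. Hence Q, and with it Q^2 = 1 -
  S^2, has norm at most 1.\<close>

lemma norm_one_minus_square_le:
  assumes S: "sa S" "norm S \<le> 1"
  shows "norm (1 - S * S) \<le> 1"
proof -
  have "norm (S * S) \<le> 1"
    using S by (intro order_trans[OF norm_mult_ineq] mult_le_one) simp_all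
  then obtain Q where Q: "sa Q" "Q * Q = 1 - S * S" "\<And>Z. Z * (S * S) = S * S * Z \<Longrightarrow> Z * Q = Q * Z"
    using sqrt_one_minus[of "S * S"] S sa_mult by metis
  have "norm Q \<le> 1"
    using S by (intro norm_le_one_of_squares[OF Q(1) S(1) Q(3)[symmetric]]) (auto simp: Q(2) mult.assoc)
  then show ?thesis
    unfolding Q(2)[symmetric] using norm_mult_ineq[of Q Q] mult_le_one[of "norm Q" "norm Q"] by simp
qed

section \<open>The cone of squares of self-adjoint elements\<close>

lemma pos_imp_sa: "pos K \<Longrightarrow> sa K"
  by (auto simp: pos_def intro: sa_mult)

lemma pos_scaleR: assumes "pos K" "0 \<le> r" shows "pos (r *\<^sub>R K)"
proof -
  obtain S where "sa S" "K = S * S"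
    using assms by (auto simp: pos_def)
  then show ?thesis
    using assms(2) unfolding pos_def
    by (intro exI[of _ "sqrt r *\<^sub>R S"]) (auto intro: adj_scaleR)
qed

text \<open>K/t has the form 1 - X with X of norm at most 1, so it has a square root. Together with
  \<open>pos_norm_diff_le\<close> this describes positivity by norms instead of spectra.\<close>

lemma pos_if_norm_diff_le:
  assumes "sa K" "norm (t *\<^sub>R 1 - K) \<le> t" "0 < t"
  shows "pos K"
proof -
  let ?X = "1 - (1/t) *\<^sub>R K"
  have "?X = (1/t) *\<^sub>R (t *\<^sub>R 1 - K)"
    using assms by (simp add: scaleR_diff_right)
  then have "norm ?X \<le> 1"
    using assms by simp
  then obtain Q where "sa Q" "Q * Q = 1 - ?X"
    using sqrt_one_minus[of ?X] assms adj_diff adj_one adj_scaleR by metis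
  then have "pos ((1/t) *\<^sub>R K)"
    unfolding pos_def by (metis add_diff_cancel_left' diff_add_cancel)
  from pos_scaleR[OF this, of t] show ?thesis
    using assms by simp
qed

lemma pos_norm_one_minus_le:
  assumes "pos K" "norm K \<le> 1"
  shows "norm (1 - K) \<le> 1"
proof -
  obtain S where S: "sa S" "K = S * S"
    using assms by (auto simp: pos_def)
  then have "(norm S)\<^sup>2 \<le> 1"
    using norm_adj_mult[of S S] assms by simp
  then show ?thesis
    using S norm_one_minus_square_le by (simp add: power_le_one_iff)
qed

text \<open>The converse of \<open>pos_if_norm_diff_le\<close>, for every t that bounds the norm of
  K.\<close>

lemma pos_norm_diff_le:
  assumes "pos K" "norm K \<le> t" "0 < t"
  shows "norm (t *\<^sub>R 1 - K) \<le> t"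
proof -
  have "norm (1 - (1/t) *\<^sub>R K) \<le> 1"
    using assms by (intro pos_norm_one_minus_le pos_scaleR) auto
  moreover have "t *\<^sub>R 1 - K = t *\<^sub>R (1 - (1/t) *\<^sub>R K)"
    using assms by (simp add: scaleR_diff_right)
  ultimately show ?thesis
    using assms by simp
qed

text \<open>In the description of positivity by norms, the radii of K and L add up by the triangle
  inequality.\<close>

lemma pos_add:
  assumes "pos K" "pos L"
  shows "pos (K + L)"
proof (rule pos_if_norm_diff_le)
  \<comment> \<open>The added 1 keeps the radii positive even if K or L is 0.\<close>
  let ?s = "norm K + 1" and ?t = "norm L + 1"
  have "norm (?s *\<^sub>R 1 - K) \<le> ?s" "norm (?t *\<^sub>R 1 - L) \<le> ?t"
    by (auto intro!: pos_norm_diff_le assms add_nonneg_pos)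
  moreover have "(?s + ?t) *\<^sub>R 1 - (K + L) = (?s *\<^sub>R 1 - K) + (?t *\<^sub>R 1 - L)"
    by (simp add: scaleR_add_left scaleR_2)
  ultimately show "norm ((?s + ?t) *\<^sub>R 1 - (K + L)) \<le> ?s + ?t"
    by (metis add_mono norm_triangle_le)
  show "0 < ?s + ?t"
    using norm_ge_zero[of K] norm_ge_zero[of L] by linarith
qed (use assms in \<open>auto intro: adj_add pos_imp_sa\<close>)

lemma pos_sqrt:
  assumes "pos K"
  obtains R where "sa R" "R * R = K" "\<And>Z. Z * K = K * Z \<Longrightarrow> Z * R = R * Z"
proof -
  define t where "t = norm K + 1"
  have t: "0 < t" "norm K \<le> t"
    by (auto simp: t_def add_nonneg_pos)
  let ?X = "1 - (1/t) *\<^sub>R K"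
  have "norm ?X \<le> 1"
    using assms t by (intro pos_norm_one_minus_le pos_scaleR) auto
  moreover have "sa ?X"
    using assms by (intro adj_diff adj_one adj_scaleR pos_imp_sa)
  ultimately obtain Q where Q: "sa Q" "Q * Q = 1 - ?X" "\<And>Z. Z * ?X = ?X * Z \<Longrightarrow> Z * Q = Q * Z"
    using sqrt_one_minus by metis
  show ?thesis
  proof (rule that[of "sqrt t *\<^sub>R Q"])
    show "sqrt t *\<^sub>R Q * sqrt t *\<^sub>R Q = K"
      using Q(2) t by simp
    show "Z * sqrt t *\<^sub>R Q = sqrt t *\<^sub>R Q * Z" if "Z * K = K * Z" for Z
      using Q(3)[of Z] that by (simp add: algebra_simps)
  qed (rule adj_scaleR[OF Q(1)])
qed

text \<open>Commuting roots R of 1 + H and Q of 1 - H satisfy H^2 + (R Q)^2 = H^2 + (1 + H)(1 - H) =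
  1, so \<open>norm_le_one_of_squares\<close> applies to H and R Q.\<close>

lemma norm_le_one_if_between:
  assumes H: "pos (1 - H)" "pos (1 + H)"
  shows "norm H \<le> 1"
proof -
  have saH: "sa H"
    using adj_diff[OF pos_imp_sa[OF H(2)] adj_one] by simp
  obtain R where R: "sa R" "R * R = 1 + H" "\<And>Z. Z * (1 + H) = (1 + H) * Z \<Longrightarrow> Z * R = R * Z"
    using pos_sqrt[OF H(2)] by blast
  obtain Q where Q: "sa Q" "Q * Q = 1 - H" "\<And>Z. Z * (1 - H) = (1 - H) * Z \<Longrightarrow> Z * Q = Q * Z"
    using pos_sqrt[OF H(1)] by blast
  have HR: "H * R = R * H"
    by (rule R(3)) (simp add: algebra_simps)
  have HQ: "H * Q = Q * H"
    by (rule Q(3)) (simp add: algebra_simps)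
  have RQ: "R * Q = Q * R"
    using HR by (intro Q(3)) (simp add: algebra_simps)
  have "(R * Q) * (R * Q) = R * R * (Q * Q)"
    by (simp add: mult.assoc RQ commute_left[OF RQ])
  also have "\<dots> = 1 - H * H"
    by (simp add: R(2) Q(2) algebra_simps)
  finally have "H * H + (R * Q) * (R * Q) = 1"
    by simp
  moreover have "H * (R * Q) = (R * Q) * H"
    by (simp add: HR mult.assoc commute_left[OF HR] flip: HQ)
  ultimately show ?thesis
    using norm_le_one_of_squares[OF saH sa_mult[OF R(1) Q(1) RQ]] by blast
qed

lemma pos_one_minus: "pos K \<Longrightarrow> norm K \<le> 1 \<Longrightarrow> pos (1 - K)"
  using pos_if_norm_diff_le[of "1 - K" 1] by (simp add: adj_diff adj_one pos_imp_sa)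

text \<open>K - L lies between -1 and 1, since 1 - (K - L) = (1 - K) + L and 1 + (K - L) = (1 - L) +
  K are sums of positive elements.\<close>

lemma norm_pos_diff_le_one:
  assumes "pos K" "norm K \<le> 1" "pos L" "norm L \<le> 1"
  shows "norm (K - L) \<le> 1"
  using pos_add[OF pos_one_minus[OF assms(1,2)] assms(3)]
    pos_add[OF pos_one_minus[OF assms(3,4)] assms(1)]
  by (intro norm_le_one_if_between) (simp_all add: algebra_simps)

lemma pos_one: "pos 1"
  unfolding pos_def by (rule exI[of _ 1]) (simp add: adj_one)

text \<open>Every positive multiple of K would lie between -1 and 1 and so have norm at most 1; the
  chosen multiple has norm 2.\<close>

lemma pos_antisym:
  assumes "pos K" "pos (- K)"
  shows "K = 0"
proof (rule ccontr)
  assume "K \<noteq> 0"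
  let ?r = "2 / norm K"
  have "pos (1 + ?r *\<^sub>R K)" "pos (1 - ?r *\<^sub>R K)"
    using pos_add[OF pos_one pos_scaleR[OF assms(1), of ?r]]
      pos_add[OF pos_one pos_scaleR[OF assms(2), of ?r]] by simp_all
  then have "norm (?r *\<^sub>R K) \<le> 1"
    by (intro norm_le_one_if_between)
  then show False
    using \<open>K \<noteq> 0\<close> by simp
qed

section \<open>Kaplansky's theorem\<close>

lemma pos_sum_adj_mult:
  assumes "adj T T'"
  shows "pos (T' * T + T * T')"
proof -
  \<comment> \<open>With J read as i, these are twice the real part and minus twice the imaginary
    part of T.\<close>
  let ?U = "T + T'" and ?V = "J * (T - T')"
  have U: "sa ?U"
    using adj_add[OF assms adj_sym[OF assms]] by (simp add: add.commute)
  have D: "adj (T - T') (T' - T)"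
    using adj_diff[OF assms adj_sym[OF assms]] .
  have V: "sa ?V"
  proof -
    have "(T' - T) * - J = ?V"
      using J_commute[OF D] by (simp add: algebra_simps)
    then show ?thesis
      using adj_mult[OF adj_J D] by simp
  qed
  have "?V * ?V = J * J * ((T - T') * (T - T'))"
    by (simp add: mult.assoc commute_left[OF J_commute[OF D]])
  also have "\<dots> = - ((T - T') * (T - T'))"
    by (simp add: J_square)
  finally have "?U * ?U + ?V * ?V = 2 *\<^sub>R (T' * T + T * T')"
    by (simp add: algebra_simps scaleR_2)
  moreover have "pos (?U * ?U + ?V * ?V)"
    using U V by (intro pos_add) (auto simp: pos_def)
  ultimately show ?thesis
    using pos_scaleR[of "2 *\<^sub>R (T' * T + T * T')" "1/2"] by simp
qed

text \<open>P is the absolute value of H. Unlike \<open>pos_sqrt\<close>, the construction yields a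
  root that is itself positive, by the bound on 1 - Q.\<close>

lemma sa_abs:
  assumes "sa H"
  obtains P where "pos P" "P * P = H * H" "\<And>Z. Z * H = H * Z \<Longrightarrow> Z * P = P * Z"
proof -
  define t where "t = norm H + 1"
  have t: "0 < t" "norm H \<le> t"
    by (auto simp: t_def add_nonneg_pos)
  define G where "G = (1/t) *\<^sub>R H"
  have G: "sa G" "norm G \<le> 1" "H = t *\<^sub>R G"
    using assms t by (auto simp: G_def intro: adj_scaleR)
  let ?X = "1 - G * G"
  have "sa ?X"
    using G by (intro adj_diff adj_one sa_mult) auto
  then obtain Q where Q: "sa Q" "Q * Q = 1 - ?X" "norm (1 - Q) \<le> 1"
      "\<And>Z. Z * ?X = ?X * Z \<Longrightarrow> Z * Q = Q * Z"
    using sqrt_one_minus[OF _ norm_one_minus_square_le[OF G(1,2)]] by blast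
  show ?thesis
  proof (rule that[of "t *\<^sub>R Q"])
    show "pos (t *\<^sub>R Q)"
      using pos_if_norm_diff_le[of Q 1] Q(1,3) t by (intro pos_scaleR) auto
    show "t *\<^sub>R Q * t *\<^sub>R Q = H * H"
      using Q(2) by (simp add: G(3))
    show "Z * t *\<^sub>R Q = t *\<^sub>R Q * Z" if "Z * H = H * Z" for Z
    proof -
      have ZG: "Z * G = G * Z"
        using that by (simp add: G_def)
      have "Z * (G * G) = G * G * Z"
        by (simp add: ZG commute_left[OF ZG] mult.assoc)
      then show ?thesis
        using Q(4)[of Z] by (simp add: algebra_simps)
    qed
  qed
qed

text \<open>Kaplansky's argument. With H = D' D and M = P - H (twice its negative part), the element
  Y = D M M is such that both Y' Y and Y Y' are negatives of squares, whereas
  their sum is positive; so both vanish, and with them M.\<close>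
lemma pos_adj_mult:
  assumes D: "adj D D'"
  shows "pos (D' * D)"
proof -
  define H where "H = D' * D"
  have H: "sa H"
    using adj_mult[OF adj_sym[OF D] D] by (simp add: H_def)
  obtain P where P: "pos P" "P * P = H * H" "\<And>Z. Z * H = H * Z \<Longrightarrow> Z * P = P * Z"
    using sa_abs[OF H] by blast
  obtain R where R: "sa R" "R * R = P" "\<And>Z. Z * P = P * Z \<Longrightarrow> Z * R = R * Z"
    using pos_sqrt[OF P(1)] by blast
  define M where "M = P - H"
  have HP: "H * P = P * H"
    using P(3) by simp
  have HR: "H * R = R * H"
    using R(3) HP by simp
  have saM: "sa M"
    using H P(1) by (simp add: M_def adj_diff pos_imp_sa)
  have MR: "M * R = R * M"
    using HR by (simp add: M_def left_diff_distrib right_diff_distrib mult.assoc flip: R(2))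
  have MH: "M * H = H * M"
    using HP by (simp add: M_def algebra_simps)
  note comm_simps = mult.assoc HR[symmetric] commute_left[OF HR[symmetric]] MR commute_left[OF MR]
    MH commute_left[OF MH]
  \<comment> \<open>As P^2 = H^2 and P commutes with H, both identities come from M^2 = 2 (H^2 - H
    P).\<close>
  have HM: "2 *\<^sub>R (H * M) = - (M * M)"
    using HP P(2) by (simp add: M_def algebra_simps scaleR_2)
  have PM: "2 *\<^sub>R (P * M) = M * M"
    using HP P(2) by (simp add: M_def algebra_simps scaleR_2)
  \<comment> \<open>This form of M^4 turns both products into negative squares: H M^4 = -4 (H R
    M)^2, and, with H = D' D in the middle, D M^4 D' = -4 (D M R D')^2.\<close>
  have M4: "M * M * (M * M) = - (4 *\<^sub>R (M * R * H * R * M))"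
  proof -
    have "M * R * H * R * M = H * M * (P * M)"
      by (simp add: comm_simps flip: R(2))
    then have "4 *\<^sub>R (M * R * H * R * M) = 2 *\<^sub>R (H * M) * 2 *\<^sub>R (P * M)"
      by simp
    then show ?thesis
      by (simp add: HM PM)
  qed
  define Y where "Y = D * (M * M)"
  define Y' where "Y' = M * M * D'"
  have "adj Y Y'"
    using adj_mult[OF D adj_mult[OF saM saM]] by (simp add: Y_def Y'_def)
  then have sum: "pos (Y' * Y + Y * Y')"
    by (rule pos_sum_adj_mult)
  define A where "A = H * (R * M)"
  define B where "B = D * (M * R) * D'"
  have saA: "sa A"
    using H saM R(1) HR MH MR unfolding A_def by (intro sa_mult) (simp_all add: comm_simps)
  have saB: "sa B"
    using adj_mult[OF adj_mult[OF D sa_mult[OF saM R(1) MR]] adj_sym[OF D]] by (simp add: B_def mult.assoc)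
  have Y'Y: "Y' * Y = - (4 *\<^sub>R (A * A))"
  proof -
    have "Y' * Y = H * (M * M * (M * M))"
    proof -
      have "Y' * Y = M * M * H * (M * M)"
        by (simp add: Y_def Y'_def H_def mult.assoc)
      then show ?thesis
        by (simp add: comm_simps)
    qed
    moreover have "A * A = H * (M * R * H * R * M)"
      by (simp add: A_def comm_simps)
    ultimately show ?thesis
      by (simp add: M4)
  qed
  have YY': "Y * Y' = - (4 *\<^sub>R (B * B))"
  proof -
    have "Y * Y' = D * (M * M * (M * M)) * D'"
      by (simp add: Y_def Y'_def mult.assoc)
    moreover have "B * B = D * (M * R * H * R * M) * D'"
    proof -
      have "B * B = D * (M * R * H * (M * R)) * D'"
        by (simp add: B_def H_def mult.assoc)
      then show ?thesis
        by (simp add: comm_simps)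
    qed
    ultimately show ?thesis
      by (simp add: M4)
  qed
  have posA: "pos (A * A)" and posB: "pos (B * B)"
    using saA saB by (auto simp: pos_def)
  have sum_eq: "Y' * Y + Y * Y' = - (4 *\<^sub>R (A * A + B * B))"
    by (simp add: Y'Y YY' scaleR_add_right)
  \<comment> \<open>A^2 + B^2 is positive as a sum of squares, and its negative is positive by
    \<open>sum\<close>. The same antisymmetry then removes A^2 = - B^2.\<close>
  have "4 *\<^sub>R (A * A + B * B) = 0"
    using pos_antisym[of "4 *\<^sub>R (A * A + B * B)"] pos_scaleR[OF pos_add[OF posA posB], of 4] sum
    by (simp add: sum_eq)
  then have "A * A = - (B * B)"
    by (simp add: add_eq_0_iff2)
  then have "A * A = 0"
    using pos_antisym[of "A * A"] posA posB by simp
  then have "A = 0"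
    using saA sa_square_eq_0 by blast
  \<comment> \<open>R A = H P M. By 2 P M = M^2 this gives H M^2 = 0, then 2 H M = - M^2 gives M^3 =
    0; so M^4 = 0 and M = 0, that is, H = P.\<close>
  then have "R * A = 0"
    by simp
  then have "H * (P * M) = 0"
    by (simp add: A_def comm_simps flip: R(2))
  then have "H * (2 *\<^sub>R (P * M)) = 0"
    by simp
  then have "2 *\<^sub>R (H * M) * M = 0"
    by (simp add: PM mult.assoc)
  then have "M * M * M * M = 0"
    by (simp add: HM)
  then have "M * M * (M * M) = 0"
    by (simp add: mult.assoc)
  then have "M = 0"
    using sa_square_eq_0 sa_mult saM by metis
  then show ?thesis
    using P(1) by (simp add: M_def H_def)
qed

end

section \<open>Sublinear functionals\<close>

definition sublinear :: "('v::real_vector \<Rightarrow> real) \<Rightarrow> bool" where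
  "sublinear q \<longleftrightarrow> (\<forall>x y. q (x + y) \<le> q x + q y) \<and> (\<forall>r\<ge>0. \<forall>x. q (r *\<^sub>R x) = r * q x)"

text \<open>The right derivative of q at v: substituting t = 1/h turns the difference quotient
  (q (v + h x) - q v) / h, which decreases as h decreases, into the expression below.\<close>
definition shift :: "('v::real_vector \<Rightarrow> real) \<Rightarrow> 'v \<Rightarrow> 'v \<Rightarrow> real" where
  "shift q v x = (INF t\<in>{0..}. q (x + t *\<^sub>R v) - t * q v)"

lemma sublinear_add: "sublinear q \<Longrightarrow> q (x + y) \<le> q x + q y"
  by (simp add: sublinear_def)

lemma sublinear_scaleR: "sublinear q \<Longrightarrow> 0 \<le> r \<Longrightarrow> q (r *\<^sub>R x) = r * q x"
  by (simp add: sublinear_def)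

lemma sublinear_zero: "sublinear q \<Longrightarrow> q 0 = 0"
  using sublinear_scaleR[of q 0 0] by simp

lemma sublinear_minus: "sublinear q \<Longrightarrow> - q (- x) \<le> q x"
  using sublinear_add[of q x "- x"] sublinear_zero[of q] by simp

text \<open>One inequality suffices for homogeneity: applied with 1/r it gives the reverse
  one.\<close>

lemma sublinearI:
  assumes add: "\<And>x y. q (x + y) \<le> q x + q y" and zero: "q 0 = 0"
    and scale_le: "\<And>r x. 0 < r \<Longrightarrow> q (r *\<^sub>R x) \<le> r * q x"
  shows "sublinear q"
proof -
  have "q (r *\<^sub>R x) = r * q x" if "0 \<le> r" for r x
  proof (cases "r = 0")
    case False
    then have "0 < r"
      using that by simp
    then have "r * q x \<le> q (r *\<^sub>R x)"
      using scale_le[of "1/r" "r *\<^sub>R x"] by (simp add: field_simps)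
    then show ?thesis
      using scale_le[OF \<open>0 < r\<close>, of x] by simp
  qed (simp add: zero)
  then show ?thesis
    unfolding sublinear_def using add by blast
qed

lemma sublinear_norm: "sublinear norm"
  by (simp add: sublinear_def norm_triangle_ineq)

context
  fixes q :: "'v::real_vector \<Rightarrow> real"
  assumes q: "sublinear q"
begin

lemma bdd_below_shift: "bdd_below ((\<lambda>t. q (x + t *\<^sub>R v) - t * q v) ` {0..})"
proof (rule bdd_belowI2)
  fix t :: real
  assume "t \<in> {0..}"
  then have "t * q v = q (t *\<^sub>R v)"
    using sublinear_scaleR[OF q] by simp
  then show "- q (- x) \<le> q (x + t *\<^sub>R v) - t * q v"
    using sublinear_add[OF q, of "x + t *\<^sub>R v" "- x"] by simp
qed

lemma shift_le: "0 \<le> t \<Longrightarrow> shift q v x \<le> q (x + t *\<^sub>R v) - t * q v"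
  unfolding shift_def by (rule cINF_lower[OF bdd_below_shift]) simp

lemma shift_greatest: "(\<And>t. 0 \<le> t \<Longrightarrow> m \<le> q (x + t *\<^sub>R v) - t * q v) \<Longrightarrow> m \<le> shift q v x"
  unfolding shift_def by (rule cINF_greatest) auto

lemma shift_le_self: "shift q v x \<le> q x"
  using shift_le[of 0 v x] by simp

text \<open>This forces norming: a linear f below \<open>shift q v\<close> satisfies f v \<ge> q
  v.\<close>

lemma shift_minus_self: "shift q v (- v) \<le> - q v"
  using shift_le[of 1 v "- v"] sublinear_zero[OF q] by simp

lemma sublinear_shift: "sublinear (shift q v)"
proof -
  have add: "shift q v (x + y) \<le> shift q v x + shift q v y" for x y
  proof -
    \<comment> \<open>Parameters s for x and t for y give the parameter s + t for x + y. The infimum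
      is taken over t first and over s afterwards.\<close>
    have "shift q v (x + y) - (q (x + s *\<^sub>R v) - s * q v) \<le> shift q v y" if "0 \<le> s" for s
    proof (rule shift_greatest)
      fix t :: real
      assume "0 \<le> t"
      then have "shift q v (x + y) \<le> q ((x + s *\<^sub>R v) + (y + t *\<^sub>R v)) - (s + t) * q v"
        using shift_le[of "s + t" v "x + y"] that by (simp add: algebra_simps)
      then show "shift q v (x + y) - (q (x + s *\<^sub>R v) - s * q v) \<le> q (y + t *\<^sub>R v) - t * q v"
        using sublinear_add[OF q, of "x + s *\<^sub>R v" "y + t *\<^sub>R v"] by (simp add: algebra_simps)
    qed
    then have "shift q v (x + y) - shift q v y \<le> shift q v x"
      by (intro shift_greatest) (simp add: algebra_simps)
    then show ?thesis
      by simp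
  qed
  have scale_le: "shift q v (r *\<^sub>R x) \<le> r * shift q v x" if "0 < r" for r x
  proof -
    have "shift q v (r *\<^sub>R x) / r \<le> shift q v x"
    proof (rule shift_greatest)
      fix t :: real
      assume "0 \<le> t"
      then have "shift q v (r *\<^sub>R x) \<le> q (r *\<^sub>R (x + t *\<^sub>R v)) - (r * t) * q v"
        using shift_le[of "r * t" v "r *\<^sub>R x"] that by (simp add: scaleR_add_right)
      also have "\<dots> = r * (q (x + t *\<^sub>R v) - t * q v)"
        using sublinear_scaleR[OF q, of r "x + t *\<^sub>R v"] that by (simp add: right_diff_distrib)
      finally show "shift q v (r *\<^sub>R x) / r \<le> q (x + t *\<^sub>R v) - t * q v"
        using that by (simp add: divide_le_eq mult.commute)
    qed
    then show ?thesis
      using that by (simp add: divide_le_eq mult.commute)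
  qed
  have "0 \<le> shift q v 0"
    by (rule shift_greatest) (simp add: sublinear_scaleR[OF q])
  then have zero: "shift q v 0 = 0"
    using shift_le_self[of v 0] sublinear_zero[OF q] by simp
  show ?thesis
    using add zero scale_le by (rule sublinearI)
qed

end

section \<open>Hahn-Banach by minimal sublinear functionals\<close>

lemma minimal_sublinear_imp_linear:
  assumes q: "sublinear q" and min: "\<And>q'. sublinear q' \<Longrightarrow> q' \<le> q \<Longrightarrow> q' = q"
  shows "linear q"
proof -
  \<comment> \<open>The shift is sublinear and below q, so minimality makes it q. Its parameter t =
    1 then reverses subadditivity.\<close>
  have "shift q v = q" for v
    by (rule min[OF sublinear_shift[OF q]]) (simp add: le_fun_def shift_le_self[OF q])
  then have "q x \<le> q (x + v) - q v" for x v
    using shift_le[OF q, of 1 v x] by simp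
  then have add: "q (x + v) = q x + q v" for x v
    using sublinear_add[OF q, of x v] by (simp add: algebra_simps antisym)
  have minus: "q (- x) = - q x" for x
    using add[of x "- x"] sublinear_zero[OF q] by simp
  have "q (r *\<^sub>R x) = r * q x" for r x
  proof (cases "0 \<le> r")
    case False
    then show ?thesis
      using sublinear_scaleR[OF q, of "- r" x] by (simp add: minus)
  qed (rule sublinear_scaleR[OF q])
  with add show ?thesis
    by (intro linearI) simp_all
qed

text \<open>Zorn's lemma for the reversed pointwise order; a nonempty chain is bounded by its
  pointwise infimum.\<close>

lemma minimal_sublinear_exists:
  assumes p: "sublinear p"
  obtains q where "sublinear q" "q \<le> p" "\<And>q'. sublinear q' \<Longrightarrow> q' \<le> q \<Longrightarrow> q' = q"
proof -
  let ?A = "{q. sublinear q \<and> q \<le> p}"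
  let ?r = "relation_of (\<lambda>q q'. q' \<le> q) ?A"
  have "\<exists>m\<in>?A. \<forall>q\<in>?A. q \<le> m \<longrightarrow> q = m"
  proof (rule predicate_Zorn)
    show "partial_order_on ?A ?r"
      by (auto intro!: partial_order_on_relation_ofI)
  next
    fix C
    assume C: "C \<in> Chains ?r"
    then have C_sub: "sublinear q" "q \<le> p" if "q \<in> C" for q
      using that by (auto simp: Chains_def relation_of_def)
    have C_chain: "q \<le> q' \<or> q' \<le> q" if "q \<in> C" "q' \<in> C" for q q'
      using that C by (auto simp: Chains_def relation_of_def)
    show "\<exists>u\<in>?A. \<forall>q\<in>C. u \<le> q"
    proof (cases "C = {}")
      case True
      then show ?thesis
        using p by auto
    next
      case False
      define u where "u x = (INF q\<in>C. q x)" for x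
      \<comment> \<open>A lower bound common to the whole chain, so that the real infimum is
        meaningful.\<close>
      have "- p (- x) \<le> q x" if "q \<in> C" for q x
        using le_funD[OF C_sub(2)[OF that], of "- x"] sublinear_minus[OF C_sub(1)[OF that], of x] by linarith
      then have bdd: "bdd_below ((\<lambda>q. q x) ` C)" for x
        by (rule bdd_belowI2)
      have u_le: "u x \<le> q x" if "q \<in> C" for q x
        unfolding u_def by (rule cINF_lower[OF bdd that])
      have u_ge: "m \<le> u x" if "\<And>q. q \<in> C \<Longrightarrow> m \<le> q x" for m x
        unfolding u_def by (rule cINF_greatest[OF False that])
      \<comment> \<open>Comparability enters here: the smaller of q and q' bounds both arguments at
        once.\<close>
      have two: "u (x + y) \<le> q x + q' y" if qq: "q \<in> C" "q' \<in> C" for x y q q'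
      proof -
        obtain k where k: "k \<in> C" "k \<le> q" "k \<le> q'"
          using C_chain[OF qq] qq by auto
        have "u (x + y) \<le> k x + k y"
          using u_le[OF k(1), of "x + y"] sublinear_add[OF C_sub(1)[OF k(1)], of x y] by linarith
        then show ?thesis
          using le_funD[OF k(2), of x] le_funD[OF k(3), of y] by linarith
      qed
      have add: "u (x + y) \<le> u x + u y" for x y
      proof -
        have "u (x + y) - q x \<le> u y" if "q \<in> C" for q
        proof (rule u_ge)
          show "u (x + y) - q x \<le> q' y" if "q' \<in> C" for q'
            using two[OF \<open>q \<in> C\<close> that, of x y] by linarith
        qed
        then have "u (x + y) - u y \<le> q x" if "q \<in> C" for q
          using that by (metis diff_le_eq add.commute)
        then have "u (x + y) - u y \<le> u x"
          by (rule u_ge)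
        then show ?thesis
          by linarith
      qed
      have scale_le: "u (r *\<^sub>R x) \<le> r * u x" if "0 < r" for r x
      proof -
        have "u (r *\<^sub>R x) / r \<le> u x"
        proof (rule u_ge)
          fix q
          assume "q \<in> C"
          then show "u (r *\<^sub>R x) / r \<le> q x"
            using u_le[OF \<open>q \<in> C\<close>, of "r *\<^sub>R x"] sublinear_scaleR[OF C_sub(1)[OF \<open>q \<in> C\<close>], of r x] that
            by (simp add: divide_le_eq mult.commute)
        qed
        then show ?thesis
          using that by (simp add: divide_le_eq mult.commute)
      qed
      obtain q where q: "q \<in> C"
        using False by blast
      have zero: "q 0 = 0" if "q \<in> C" for q
        by (rule sublinear_zero[OF C_sub(1)[OF that]])
      have "u 0 = 0"
      proof (rule antisym)
        show "u 0 \<le> 0"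
          using u_le[OF q, of 0] unfolding zero[OF q] .
        show "0 \<le> u 0"
          by (rule u_ge) (rule eq_refl[OF zero[symmetric]])
      qed
      with add have "sublinear u"
        using scale_le by (rule sublinearI)
      moreover have "u \<le> p"
      proof (rule le_funI)
        show "u x \<le> p x" for x
          using u_le[OF q, of x] le_funD[OF C_sub(2)[OF q], of x] by linarith
      qed
      moreover have "\<forall>q\<in>C. u \<le> q"
        using u_le by (intro ballI le_funI)
      ultimately show ?thesis
        by blast
    qed
  qed
  then obtain m where m: "sublinear m" "m \<le> p" "\<And>q. sublinear q \<Longrightarrow> q \<le> p \<Longrightarrow> q \<le> m \<Longrightarrow> q = m"
    by blast
  show ?thesis
    using m(1,2) by (rule that) (use m(2,3) order_trans in blast)
qed

text \<open>No extension from a subspace is made. A minimal sublinear functional below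
  \<open>shift p b\<close> is linear, and its value at - b is at most - p b, which forces equality
  at b.\<close>

lemma dominated_linear_exists:
  assumes p: "sublinear p"
  obtains f where "linear f" "\<And>x. f x \<le> p x" "f b = p b"
proof -
  obtain f where f: "sublinear f" "f \<le> shift p b" "\<And>q'. sublinear q' \<Longrightarrow> q' \<le> f \<Longrightarrow> q' = f"
    using minimal_sublinear_exists[OF sublinear_shift[OF p]] by blast
  have lin: "linear f"
    using minimal_sublinear_imp_linear f by blast
  have le: "f x \<le> p x" for x
    using f(2) shift_le_self[OF p] by (meson le_funD order_trans)
  have "f (- b) \<le> - p b"
    using f(2) shift_minus_self[OF p] by (meson le_funD order_trans)
  then have "f b = p b"
    using le[of b] linear_neg[OF lin, of b] by simp
  with lin le show ?thesis
    using that by blast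
qed

text \<open>The difference quotient at t is the expression under the infimum with parameter 1/t.
  That expression decreases in its parameter, by the triangle inequality, so the infimum is the
  limit as t decreases to 0.\<close>

lemma shift_norm_tendsto:
  fixes a b :: "'v::real_normed_vector"
  shows "((\<lambda>t. (norm (a + t *\<^sub>R b) - norm a) / t) \<longlongrightarrow> shift norm a b) (at_right 0)"
proof -
  have quotient: "(norm (a + t *\<^sub>R b) - norm a) / t = norm (b + (1/t) *\<^sub>R a) - (1/t) * norm a"
    if "0 < t" for t
  proof -
    have "b + (1/t) *\<^sub>R a = (1/t) *\<^sub>R (a + t *\<^sub>R b)"
      using that by (simp add: scaleR_add_right)
    then show ?thesis
      using that by (simp add: diff_divide_distrib)
  qed
  show ?thesis
  proof (rule order_tendstoI)
    fix y
    assume y: "y < shift norm a b"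
    have "y < (norm (a + t *\<^sub>R b) - norm a) / t" if "0 < t" for t
      using y shift_le[OF sublinear_norm, of "1/t" a b] that unfolding quotient[OF that] by simp
    then show "\<forall>\<^sub>F t in at_right 0. y < (norm (a + t *\<^sub>R b) - norm a) / t"
      using eventually_at_right_less by (rule eventually_mono[rotated])
  next
    fix y
    assume "shift norm a b < y"
    then obtain s where s: "0 \<le> s" "norm (b + s *\<^sub>R a) - s * norm a < y"
      using shift_greatest[of norm y b a] sublinear_norm by (meson not_le)
    \<comment> \<open>The threshold ensures 1/t > s; the 1 in it covers s = 0.\<close>
    have "(norm (a + t *\<^sub>R b) - norm a) / t < y" if "0 < t" "t < 1 / (s + 1)" for t
    proof -
      have "s + 1 < 1 / t"
        using that s(1) by (simp add: field_simps)
      then have "norm ((1/t - s) *\<^sub>R a) = (1/t - s) * norm a"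
        by simp
      moreover have "b + (1/t) *\<^sub>R a = (b + s *\<^sub>R a) + (1/t - s) *\<^sub>R a"
        by (simp add: scaleR_diff_left)
      ultimately have "norm (b + (1/t) *\<^sub>R a) \<le> norm (b + s *\<^sub>R a) + (1/t - s) * norm a"
        by (metis norm_triangle_ineq)
      then show ?thesis
        unfolding quotient[OF that(1)] using s(2) by (simp add: algebra_simps)
    qed
    then show "\<forall>\<^sub>F t in at_right 0. (norm (a + t *\<^sub>R b) - norm a) / t < y"
      unfolding eventually_at_right_field using s(1) by (intro exI[of _ "1 / (s + 1)"]) auto
  qed
qed

section \<open>States of a C*-algebra\<close>

text \<open>The left regular representation: it places an algebra that may lack a unit inside a
  unital one.\<close>

definition left_mult :: "'a::real_normed_algebra \<Rightarrow> 'a endo" where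
  "left_mult a = Endo (Blinfun (\<lambda>x. a * x))"

lemma operator_left_mult [simp]: "operator (left_mult a) x = a * x"
  by (simp add: left_mult_def Endo_inverse bounded_linear_Blinfun_apply bounded_linear_mult_right)

lemma left_mult_mult: "left_mult (a * b) = left_mult a * left_mult b"
  by (rule endo_eqI) (simp add: mult.assoc)

lemma left_mult_diff: "left_mult (a - b) = left_mult a - left_mult b"
  by (rule endo_eqI) (simp add: left_diff_distrib)

lemma norm_left_mult_le: "norm (left_mult a) \<le> norm a"
  by (rule norm_endo_bound) (simp_all add: norm_mult_ineq)

lemma operator_tendsto:
  assumes "X \<longlonglongrightarrow> L"
  shows "(\<lambda>n. operator (X n) x) \<longlonglongrightarrow> operator L x"
proof -
  have "bounded_linear (\<lambda>S. operator S x)"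
    by (rule bounded_linear_intro[of _ "norm x"]) (simp_all add: norm_operator)
  then show ?thesis
    using assms by (rule bounded_linear.tendsto)
qed

locale cstar =
  fixes sm :: "complex \<Rightarrow> 'a::{real_normed_algebra,banach} \<Rightarrow> 'a" and star :: "'a \<Rightarrow> 'a"
  assumes cstar_algebra: "cstar_algebra sm star"
begin

lemma sm_of_real: "sm (complex_of_real r) a = r *\<^sub>R a"
  and sm_sm: "sm c (sm d a) = sm (c * d) a"
  and sm_add: "sm c (a + b) = sm c a + sm c b"
  and sm_add_left: "sm (c + d) a = sm c a + sm d a"
  and norm_sm: "norm (sm c a) = cmod c * norm a"
  and star_add: "star (a + b) = star a + star b"
  and star_sm: "star (sm c a) = sm (cnj c) (star a)"
  and star_star [simp]: "star (star a) = a"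
  and star_mult: "star (a * b) = star b * star a"
  and norm_star_mult: "norm (star a * a) = (norm a)\<^sup>2"
  using cstar_algebra unfolding cstar_algebra_def complex_scalar_def by simp_all

lemma sm_mult_left: "sm c a * b = sm c (a * b)"
  and sm_mult_right: "a * sm c b = sm c (a * b)"
  using cstar_algebra unfolding cstar_algebra_def by metis+

lemma sm_scaleR: "sm c (r *\<^sub>R a) = r *\<^sub>R sm c a"
  by (simp add: sm_sm mult.commute flip: sm_of_real)

lemma sm_one: "sm 1 a = a"
  using sm_of_real[of 1 a] by simp

lemma sm_minus_left: "sm (- c) a = - sm c a"
proof -
  have "sm (- c) a = sm (complex_of_real (- 1)) (sm c a)"
    by (simp add: sm_sm)
  then show ?thesis
    by (simp only: sm_of_real) simp
qed

lemma star_scaleR: "star (r *\<^sub>R a) = r *\<^sub>R star a"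
  by (simp add: star_sm flip: sm_of_real)

lemma norm_star: "norm (star a) = norm a"
proof -
  have le: "norm b \<le> norm (star b)" for b
  proof (cases "b = 0")
    case False
    have "norm b * norm b \<le> norm (star b) * norm b"
      using norm_mult_ineq[of "star b" b] by (simp add: norm_star_mult power2_eq_square)
    then show ?thesis
      using False by simp
  qed simp
  show ?thesis
    using le[of a] le[of "star a"] by simp
qed

lemma bounded_linear_star: "bounded_linear star"
  by (rule bounded_linear_intro[of _ 1]) (simp_all add: star_add star_scaleR norm_star)

lemma bounded_linear_sm: "bounded_linear (sm c)"
  by (rule bounded_linear_intro[of _ "cmod c"]) (simp_all add: sm_add sm_scaleR norm_sm mult.commute)

section \<open>Adjointable operators on the C*-algebra\<close>

lemma eqI_star_mult:
  assumes "\<And>z. star z * a = star z * b"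
  shows "a = b"
proof -
  have "star (a - b) * (a - b) = 0"
    using assms[of "a - b"] by (simp add: right_diff_distrib)
  then have "(norm (a - b))\<^sup>2 = 0"
    by (metis norm_star_mult norm_zero)
  then show ?thesis
    by simp
qed

text \<open>The algebra is regarded as a Hilbert module over itself with inner product
  \<open>star x * y\<close>. A relation is used because a bounded operator need not have an
  adjoint.\<close>

definition adjoint :: "'a endo \<Rightarrow> 'a endo \<Rightarrow> bool" where
  "adjoint S T \<longleftrightarrow> (\<forall>x y. star (operator S x) * y = star x * operator T y)"

definition imaginary :: "'a endo" where
  "imaginary = Endo (Blinfun (sm \<i>))"

lemma operator_imaginary: "operator imaginary x = sm \<i> x"
  by (simp add: imaginary_def Endo_inverse bounded_linear_Blinfun_apply bounded_linear_sm)

lemma adjoint_left_mult: "adjoint (left_mult a) (left_mult (star a))"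
  by (simp add: adjoint_def star_mult mult.assoc)

lemma adjointD: "adjoint S T \<Longrightarrow> star (operator S x) * y = star x * operator T y"
  by (simp add: adjoint_def)

lemma adjoint_sym: assumes "adjoint S T" shows "adjoint T S"
  unfolding adjoint_def
proof (intro allI)
  fix x y
  have "star (star (operator S y) * x) = star (star y * operator T x)"
    using adjointD[OF assms] by simp
  then show "star (operator T x) * y = star x * operator S y"
    by (simp add: star_mult)
qed

sublocale adjoint_algebra adjoint imaginary
proof
  fix S T S' T' :: "'a endo" and r :: real
  assume S: "adjoint S T"
  show "adjoint T S"
    using S by (rule adjoint_sym)
  show "adjoint (r *\<^sub>R S) (r *\<^sub>R T)"
    using S by (simp add: adjoint_def star_scaleR)
  show "(norm S)\<^sup>2 \<le> norm (T * S)"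
  proof -
    have "norm (operator S x) \<le> sqrt (norm (T * S)) * norm x" for x
    proof (rule power2_le_imp_le)
      have "(norm (operator S x))\<^sup>2 = norm (star x * operator (T * S) x)"
        using adjointD[OF S, of x "operator S x"] by (simp flip: norm_star_mult)
      also have "\<dots> \<le> norm x * norm (operator (T * S) x)"
        using norm_mult_ineq[of "star x"] by (simp only: norm_star)
      also have "\<dots> \<le> norm x * (norm (T * S) * norm x)"
        by (intro mult_left_mono norm_operator) simp
      also have "\<dots> = (sqrt (norm (T * S)) * norm x)\<^sup>2"
        by (simp add: power_mult_distrib power2_eq_square)
      finally show "(norm (operator S x))\<^sup>2 \<le> (sqrt (norm (T * S)) * norm x)\<^sup>2" .
    qed simp
    then have "norm S \<le> sqrt (norm (T * S))"
      by (intro norm_endo_bound) simp_all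
    then show ?thesis
      using power_mono[of "norm S" "sqrt (norm (T * S))" 2] by simp
  qed
  \<comment> \<open>Elements of \<open>endo\<close> are only real-linear. An adjoint forces complex
    linearity: S moves to the other factor, where i can be pulled out.\<close>
  show "S * imaginary = imaginary * S"
  proof (rule endo_eqI, rule eqI_star_mult)
    fix x z
    show "star z * operator (S * imaginary) x = star z * operator (imaginary * S) x"
      by (simp add: operator_imaginary sm_mult_right flip: adjointD[OF adjoint_sym[OF S]])
  qed
  assume S': "adjoint S' T'"
  show "adjoint (S + S') (T + T')"
    using S S' by (simp add: adjoint_def star_add distrib_left distrib_right)
  show "adjoint (S * S') (T' * T)"
    using S S' by (simp add: adjoint_def)
next
  fix X and L :: "'a endo"
  assume X: "\<And>n. adjoint (X n) (X n)" and L: "X \<longlonglongrightarrow> L"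
  show "adjoint L L"
    unfolding adjoint_def
  proof (intro allI)
    fix x y
    have "(\<lambda>n. star (operator (X n) x) * y) \<longlonglongrightarrow> star (operator L x) * y"
      by (intro tendsto_intros bounded_linear.tendsto[OF bounded_linear_star] operator_tendsto L)
    moreover have "(\<lambda>n. star x * operator (X n) y) \<longlonglongrightarrow> star x * operator L y"
      by (intro tendsto_intros operator_tendsto L)
    ultimately show "star (operator L x) * y = star x * operator L y"
      using LIMSEQ_unique adjointD[OF X] by simp
  qed
next
  show "adjoint 1 1"
    by (simp add: adjoint_def)
  show "adjoint imaginary (- imaginary)"
    by (simp add: adjoint_def operator_imaginary star_sm sm_minus_left sm_mult_left sm_mult_right)
  show "imaginary * imaginary = - 1"
    by (rule endo_eqI) (simp add: operator_imaginary sm_sm sm_minus_left sm_one)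
qed

text \<open>Evaluation at \<open>star a\<close> and the C*-identity give the lower bound.\<close>

lemma norm_left_mult: "norm (left_mult a) = norm a" for a :: 'a
proof (rule antisym[OF norm_left_mult_le])
  show "norm a \<le> norm (left_mult a)"
  proof (cases "a = 0")
    case False
    have "norm a * norm a = norm (operator (left_mult a) (star a))"
      using norm_star_mult[of "star a"] by (simp add: norm_star power2_eq_square)
    also have "\<dots> \<le> norm (left_mult a) * norm a"
      using norm_operator[of "left_mult a" "star a"] by (simp add: norm_star)
    finally show ?thesis
      using False by simp
  qed simp
qed

text \<open>Kaplansky's theorem makes the left multiplications by both terms positive; the operator
  estimate returns to the algebra by the isometry \<open>norm_left_mult\<close>.\<close>

lemma norm_star_mult_diff_le_one:
  assumes "norm (star d * d) \<le> 1" "norm (star e * e) \<le> 1"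
  shows "norm (star d * d - star e * e) \<le> 1"
proof -
  have "pos (left_mult (star a * a))" for a
    unfolding left_mult_mult by (rule pos_adj_mult[OF adjoint_left_mult])
  then have "norm (left_mult (star d * d) - left_mult (star e * e)) \<le> 1"
    using assms by (intro norm_pos_diff_le_one) (simp_all add: norm_left_mult)
  then show ?thesis
    by (simp add: norm_left_mult flip: left_mult_diff)
qed

lemma norm_star_mult_diff_le:
  assumes "norm (star d * d) \<le> t" "norm (star e * e) \<le> t" "0 < t"
  shows "norm (star d * d - star e * e) \<le> t"
proof -
  let ?r = "1 / sqrt t"
  have scaled: "star (?r *\<^sub>R a) * (?r *\<^sub>R a) = (1/t) *\<^sub>R (star a * a)" for a
    using assms(3) by (simp add: star_scaleR)
  have "norm ((1/t) *\<^sub>R (star d * d) - (1/t) *\<^sub>R (star e * e)) \<le> 1"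
    using norm_star_mult_diff_le_one[of "?r *\<^sub>R d" "?r *\<^sub>R e"] assms unfolding scaled by simp
  also have "(1/t) *\<^sub>R (star d * d) - (1/t) *\<^sub>R (star e * e) = (1/t) *\<^sub>R (star d * d - star e * e)"
    by (simp add: scaleR_diff_right)
  finally show ?thesis
    using assms(3) by simp
qed

section \<open>From norming functionals to states\<close>

lemma norming_functional_nonneg:
  assumes f: "linear f" "\<And>v. f v \<le> norm v"
    and d: "f (star d * d) = norm (star d * d)" "d \<noteq> 0"
  shows "0 \<le> f (star e * e)"
proof -
  define t where "t = norm (star d * d)"
  have t: "0 < t"
    using d(2) by (simp add: t_def norm_star_mult)
  \<comment> \<open>Scaling e by r brings \<open>star e * e\<close> to norm at most t; the added 1
    avoids division by zero.\<close>
  define r where "r = sqrt (t / (norm (star e * e) + 1))"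
  have e1: "0 < norm (star e * e) + 1"
    by (simp add: add_nonneg_pos)
  have r: "0 < r" "r * r = t / (norm (star e * e) + 1)"
    using t e1 by (simp_all add: r_def)
  have scaled: "star (r *\<^sub>R e) * (r *\<^sub>R e) = (r * r) *\<^sub>R (star e * e)"
    by (simp add: star_scaleR)
  have "norm (star (r *\<^sub>R e) * (r *\<^sub>R e)) \<le> t"
    using t e1 unfolding scaled r(2) by (simp add: divide_le_eq distrib_left)
  then have "norm (star d * d - (r * r) *\<^sub>R (star e * e)) \<le> t"
    using norm_star_mult_diff_le[of d t "r *\<^sub>R e"] t by (simp only: scaled) (simp add: t_def)
  then have "f (star d * d) - (r * r) * f (star e * e) \<le> t"
    using f(2)[of "star d * d - (r * r) *\<^sub>R (star e * e)"]
    by (simp add: linear_diff[OF f(1)] linear_scale[OF f(1)])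
  then have "0 \<le> (r * r) * f (star e * e)"
    using d(1) by (simp add: t_def)
  then show ?thesis
    using mult_le_cancel_left_pos[of "r * r" 0 "f (star e * e)"] mult_pos_pos[OF r(1) r(1)] by simp
qed

text \<open>The functional f is first symmetrised to g, so that its complexification is real on
  self-adjoint elements.\<close>
lemma state_of_norming_functional:
  assumes f: "linear f" "\<And>v. f v \<le> norm v"
    and d: "f (star d * d) = norm (star d * d)" "d \<noteq> 0"
  obtains \<phi> where "\<phi> \<in> states sm star" "\<And>v. star v = v \<Longrightarrow> \<phi> v = complex_of_real (f v)"
proof -
  define g where "g v = (f v + f (star v)) / 2" for v
  \<comment> \<open>The complex-linear functional with real part g: g v - i g (i v).\<close>
  define \<phi> where "\<phi> v = Complex (g v) (- g (sm \<i> v))" for v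
  have f_add: "f (v + w) = f v + f w" and f_scaleR: "f (r *\<^sub>R v) = r * f v" for v w r
    using linear_add[OF f(1)] linear_scale[OF f(1)] by simp_all
  have g_add: "g (v + w) = g v + g w" and g_scaleR: "g (r *\<^sub>R v) = r * g v" for v w r
    by (simp_all add: g_def star_add star_scaleR f_add f_scaleR field_simps)
  have g_le: "g v \<le> norm v" for v
    using f(2)[of v] f(2)[of "star v"] by (simp add: g_def norm_star)
  have sm_i_i: "sm \<i> (sm \<i> v) = - v" for v
    by (simp add: sm_sm sm_minus_left sm_one)
  have g_minus: "g (- v) = - g v" for v
    using g_scaleR[of "- 1" v] by simp
  have \<phi>_add: "\<phi> (v + w) = \<phi> v + \<phi> w" for v w
    by (simp add: \<phi>_def g_add sm_add complex_eq_iff)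
  have \<phi>_scaleR: "\<phi> (r *\<^sub>R v) = r *\<^sub>R \<phi> v" for r v
    by (simp add: \<phi>_def g_scaleR sm_scaleR complex_eq_iff)
  have \<phi>_i: "\<phi> (sm \<i> v) = \<i> * \<phi> v" for v
    by (simp add: \<phi>_def sm_i_i g_minus complex_eq_iff)
  have \<phi>_sm: "\<phi> (sm c v) = c * \<phi> v" for c v
  proof -
    have "sm c v = sm (complex_of_real (Re c) + \<i> * complex_of_real (Im c)) v"
      by (simp add: complex_eq flip: complex_eq)
    also have "\<dots> = Re c *\<^sub>R v + sm \<i> (Im c *\<^sub>R v)"
      by (simp add: sm_add_left sm_of_real flip: sm_sm)
    finally show ?thesis
      by (simp add: \<phi>_add \<phi>_i \<phi>_scaleR complex_eq_iff algebra_simps)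
  qed
  have \<phi>_le: "norm (\<phi> v) \<le> norm v" for v
  proof (cases "\<phi> v = 0")
    case False
    \<comment> \<open>This unimodular factor rotates the value at v onto the nonnegative axis, so
      the bound for g suffices.\<close>
    define c where "c = cnj (\<phi> v) / norm (\<phi> v)"
    have c: "cmod c = 1"
      using False by (simp add: c_def norm_divide)
    have "c * \<phi> v = complex_of_real (norm (\<phi> v))"
      using False by (simp add: c_def complex_norm_square[symmetric] power2_eq_square mult.commute)
    then have "norm (\<phi> v) = Re (\<phi> (sm c v))"
      by (simp add: \<phi>_sm)
    also have "\<dots> \<le> norm v"
      using g_le[of "sm c v"] c by (simp add: \<phi>_def norm_sm)
    finally show ?thesis .
  qed simp
  have bl: "bounded_linear \<phi>"
    by (rule bounded_linear_intro[of _ 1]) (simp_all add: \<phi>_add \<phi>_scaleR \<phi>_le)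
  have sa: "\<phi> v = complex_of_real (f v)" if "star v = v" for v
  proof -
    \<comment> \<open>For self-adjoint v, i v is skew-adjoint, so g vanishes on it, while g v = f
      v.\<close>
    have "star (sm \<i> v) = (- 1) *\<^sub>R sm \<i> v"
      using that by (simp add: star_sm sm_minus_left)
    then show ?thesis
      using that f_scaleR[of "- 1" "sm \<i> v"] by (simp add: \<phi>_def g_def complex_eq_iff)
  qed
  have sa_star_mult: "star (star e * e) = star e * e" for e
    by (simp add: star_mult)
  have "onorm \<phi> = 1"
  proof (rule antisym)
    show "onorm \<phi> \<le> 1"
      by (rule onorm_bound) (simp_all add: \<phi>_le)
    have "norm (star d * d) \<le> onorm \<phi> * norm (star d * d)"
      using onorm[OF bl, of "star d * d"] sa[OF sa_star_mult, of d] d(1) by simp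
    then show "1 \<le> onorm \<phi>"
      using d(2) by (simp add: norm_star_mult)
  qed
  moreover have "Im (\<phi> v) = 0 \<and> 0 \<le> Re (\<phi> v)" if "cstar_positive star v" for v
    using that norming_functional_nonneg[OF f d] by (auto simp: cstar_positive_def sa[OF sa_star_mult])
  ultimately have "\<phi> \<in> states sm star"
    using bl by (simp add: states_def \<phi>_add \<phi>_sm)
  then show ?thesis
    using sa that by blast
qed

lemma state_of_directional_derivative:
  assumes d: "d \<noteq> 0" and b: "star b = b"
  obtains \<phi> where "\<phi> \<in> states sm star" "\<phi> (star d * d) = complex_of_real (norm (star d * d))"
    "((\<lambda>t. (norm (star d * d + t *\<^sub>R b) - norm (star d * d)) / t) \<longlongrightarrow> Re (\<phi> b)) (at_right 0)"
proof -
  let ?a = "star d * d"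
  \<comment> \<open>Hahn-Banach is applied to the derivative instead of the norm: domination by it
    forces f to be norming at a, and its value at b can still be prescribed.\<close>
  obtain f where f: "linear f" "\<And>v. f v \<le> shift norm ?a v" "f b = shift norm ?a b"
    using dominated_linear_exists[OF sublinear_shift[OF sublinear_norm]] by blast
  have le: "f v \<le> norm v" for v
    using f(2) shift_le_self[OF sublinear_norm] order_trans by blast
  have "- f ?a \<le> - norm ?a"
    using f(2)[of "- ?a"] shift_minus_self[OF sublinear_norm, of ?a] by (simp add: linear_neg[OF f(1)])
  then have fa: "f ?a = norm ?a"
    using le[of ?a] by simp
  obtain \<phi> where \<phi>: "\<phi> \<in> states sm star" "\<And>v. star v = v \<Longrightarrow> \<phi> v = complex_of_real (f v)"
    using state_of_norming_functional[OF f(1) le fa d] by blast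
  show ?thesis
    using \<phi> f(3) fa b shift_norm_tendsto[of ?a b] by (intro that[of \<phi>]) (simp_all add: star_mult)
qed

end

section \<open>Norm derivatives in Hilbert modules\<close>

locale hilbert_cstar_module =
  fixes sm :: "complex \<Rightarrow> 'a::{real_normed_algebra,banach} \<Rightarrow> 'a"
    and star :: "'a \<Rightarrow> 'a"
    and smx :: "complex \<Rightarrow> 'x::banach \<Rightarrow> 'x"
    and act :: "'x \<Rightarrow> 'a \<Rightarrow> 'x"
    and ip :: "'x \<Rightarrow> 'x \<Rightarrow> 'a"
  assumes hilbert_module: "hilbert_module sm star smx act ip"
begin

sublocale cstar sm star
  using hilbert_module unfolding hilbert_module_def by unfold_locales (rule conjunct1)

lemma smx_of_real: "smx (complex_of_real r) x = r *\<^sub>R x"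
  and ip_add_right: "ip x (y + z) = ip x y + ip x z"
  and ip_smx_right: "ip x (smx c y) = sm c (ip x y)"
  and star_ip: "star (ip x y) = ip y x"
  and cstar_positive_ip: "cstar_positive star (ip x x)"
  and ip_self_eq_0: "ip x x = 0 \<longleftrightarrow> x = 0"
  and norm_eq_sqrt_ip: "norm x = sqrt (norm (ip x x))"
  using hilbert_module unfolding hilbert_module_def complex_scalar_def by metis+

lemma ip_add_left: "ip (x + y) z = ip x z + ip y z"
  using star_add[of "ip z x" "ip z y"] by (simp add: star_ip flip: ip_add_right)

lemma ip_smx_left: "ip (smx c x) y = sm (cnj c) (ip x y)"
  using star_sm[of c "ip y x"] by (simp add: star_ip flip: ip_smx_right)

lemma ip_scaleR_right: "ip x (r *\<^sub>R y) = r *\<^sub>R ip x y"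
  by (simp add: ip_smx_right sm_of_real flip: smx_of_real)

lemma ip_scaleR_left: "ip (r *\<^sub>R x) y = r *\<^sub>R ip x y"
  by (simp add: ip_smx_left sm_of_real flip: smx_of_real)

lemma norm_ip_self: "norm (ip x x) = (norm x)\<^sup>2"
  unfolding norm_eq_sqrt_ip[of x] by simp

lemma ip_add_scaleR:
  "ip (x + t *\<^sub>R y) (x + t *\<^sub>R y) = (ip x x + t *\<^sub>R (ip x y + ip y x)) + t\<^sup>2 *\<^sub>R ip y y"
  by (simp add: ip_add_left ip_add_right ip_scaleR_left ip_scaleR_right scaleR_add_right power2_eq_square)

text \<open>Polarisation: a state is real on the inner square of x + i y, whose cross terms are i
  times the difference of the two inner products.\<close>

lemma state_ip_commute:
  assumes "\<psi> \<in> states sm star"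
  shows "Re (\<psi> (ip y x)) = Re (\<psi> (ip x y))"
proof -
  have add: "\<psi> (a + b) = \<psi> a + \<psi> b" and scale: "\<psi> (sm c a) = c * \<psi> a"
    and real: "cstar_positive star a \<Longrightarrow> Im (\<psi> a) = 0" for a b c
    using assms by (auto simp: states_def)
  have "Im (\<psi> (ip (x + smx \<i> y) (x + smx \<i> y))) = 0"
    by (rule real[OF cstar_positive_ip])
  moreover have "ip (x + smx \<i> y) (x + smx \<i> y) =
      ip x x + sm \<i> (ip x y) + (sm (- \<i>) (ip y x) + ip y y)"
    by (simp add: ip_add_left ip_add_right ip_smx_left ip_smx_right sm_add sm_sm sm_one)
  ultimately show ?thesis
    using real[OF cstar_positive_ip, of x] real[OF cstar_positive_ip, of y]
    by (simp add: add scale)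
qed

text \<open>The squared norm of x + t y is the norm of its inner square; omitting the term in t^2
  changes the quotient by at most t times half the norm of \<open>ip y y\<close>.\<close>

lemma norm_derivative_tendsto:
  assumes "((\<lambda>t. (norm (ip x x + t *\<^sub>R (ip x y + ip y x)) - norm (ip x x)) / t) \<longlongrightarrow> l) (at_right 0)"
  shows "((\<lambda>t. ((norm (x + t *\<^sub>R y))\<^sup>2 - (norm x)\<^sup>2) / (2 * t)) \<longlongrightarrow> l / 2) (at_right 0)"
proof -
  let ?g = "\<lambda>t. (norm (ip x x + t *\<^sub>R (ip x y + ip y x)) - norm (ip x x)) / t"
  let ?h = "\<lambda>t. ((norm (x + t *\<^sub>R y))\<^sup>2 - (norm x)\<^sup>2) / (2 * t)"
  have bound: "norm (?h t - ?g t / 2) \<le> t * (norm (ip y y) / 2)" if "0 < t" for t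
  proof -
    let ?u = "ip x x + t *\<^sub>R (ip x y + ip y x)"
    have "?h t - ?g t / 2 = (norm (?u + t\<^sup>2 *\<^sub>R ip y y) - norm ?u) / (2 * t)"
      using that by (simp add: ip_add_scaleR field_simps flip: norm_ip_self)
    moreover have "\<bar>norm (?u + t\<^sup>2 *\<^sub>R ip y y) - norm ?u\<bar> \<le> t\<^sup>2 * norm (ip y y)"
      using norm_triangle_ineq3[of "?u + t\<^sup>2 *\<^sub>R ip y y" ?u] by simp
    ultimately show ?thesis
      using that by (simp add: abs_divide divide_le_eq power2_eq_square mult_ac)
  qed
  have "((\<lambda>t. ?h t - ?g t / 2) \<longlongrightarrow> 0) (at_right 0)"
  proof (rule Lim_null_comparison)
    show "\<forall>\<^sub>F t in at_right 0. norm (?h t - ?g t / 2) \<le> t * (norm (ip y y) / 2)"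
      using eventually_at_right_less bound by (rule eventually_mono)
    show "((\<lambda>t. t * (norm (ip y y) / 2)) \<longlongrightarrow> 0) (at_right 0)"
      by (auto intro!: tendsto_eq_intros)
  qed
  from tendsto_add[OF this tendsto_divide[OF assms tendsto_const[of 2]]] show ?thesis
    by simp
qed

text \<open>Apply the state to the inner square of x + t y. Its value is at most the squared norm,
  with equality at t = 0, so the quotient dominates an expression affine in t that tends to the
  claimed value.\<close>

lemma Omega_le_norm_derivative:
  assumes \<psi>: "\<psi> \<in> Omega sm star ip x"
    and lim: "((\<lambda>t. ((norm (x + t *\<^sub>R y))\<^sup>2 - (norm x)\<^sup>2) / (2 * t)) \<longlongrightarrow> l) (at_right 0)"
  shows "Re (\<psi> (ip x y)) \<le> l"
proof -
  have state: "\<psi> \<in> states sm star" and \<psi>_self: "\<psi> (ip x x) = complex_of_real ((norm x)\<^sup>2)"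
    using \<psi> by (auto simp: Omega_def)
  have \<psi>_add: "\<psi> (a + b) = \<psi> a + \<psi> b" and \<psi>_sm: "\<psi> (sm c a) = c * \<psi> a" for a b c
    using state by (auto simp: states_def)
  have \<psi>_scaleR: "\<psi> (r *\<^sub>R a) = complex_of_real r * \<psi> a" for r a
    using \<psi>_sm[of "complex_of_real r" a] by (simp add: sm_of_real)
  have "bounded_linear \<psi>" "onorm \<psi> = 1"
    using state by (auto simp: states_def)
  then have \<psi>_le: "Re (\<psi> a) \<le> norm a" for a
    using onorm[of \<psi> a] complex_Re_le_cmod[of "\<psi> a"] by simp
  let ?h = "\<lambda>t. ((norm (x + t *\<^sub>R y))\<^sup>2 - (norm x)\<^sup>2) / (2 * t)"
  have le: "Re (\<psi> (ip x y)) + t / 2 * Re (\<psi> (ip y y)) \<le> ?h t" if "0 < t" for t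
  proof -
    have "(norm x)\<^sup>2 + t * (2 * Re (\<psi> (ip x y))) + t\<^sup>2 * Re (\<psi> (ip y y)) \<le> (norm (x + t *\<^sub>R y))\<^sup>2"
      using \<psi>_le[of "ip (x + t *\<^sub>R y) (x + t *\<^sub>R y)"] state_ip_commute[OF state, of y x]
      unfolding norm_ip_self by (simp add: ip_add_scaleR \<psi>_add \<psi>_scaleR \<psi>_self)
    then show ?thesis
      using that by (simp add: le_divide_eq algebra_simps power2_eq_square)
  qed
  have "((\<lambda>t. Re (\<psi> (ip x y)) + t / 2 * Re (\<psi> (ip y y))) \<longlongrightarrow> Re (\<psi> (ip x y))) (at_right 0)"
    by (auto intro!: tendsto_eq_intros)
  moreover have "\<forall>\<^sub>F t in at_right 0. Re (\<psi> (ip x y)) + t / 2 * Re (\<psi> (ip y y)) \<le> ?h t"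
    by (rule eventually_mono[OF eventually_at_right_less le])
  ultimately show ?thesis
    by (rule tendsto_le[OF trivial_limit_at_right_real lim])
qed

lemma Omega_attains_norm_derivative:
  assumes "\<exists>a::'a. a \<noteq> 0"
  obtains \<phi> where "\<phi> \<in> Omega sm star ip x"
    "((\<lambda>t. ((norm (x + t *\<^sub>R y))\<^sup>2 - (norm x)\<^sup>2) / (2 * t)) \<longlongrightarrow> Re (\<phi> (ip x y))) (at_right 0)"
proof -
  let ?b = "ip x y + ip y x"
  have star_b: "star ?b = ?b"
    by (simp add: star_add star_ip add.commute)
  have "\<exists>\<phi>\<in>states sm star. \<phi> (ip x x) = complex_of_real (norm (ip x x)) \<and>
      ((\<lambda>t. (norm (ip x x + t *\<^sub>R ?b) - norm (ip x x)) / t) \<longlongrightarrow> Re (\<phi> ?b)) (at_right 0)"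
  proof (cases "x = 0")
    case True
    \<comment> \<open>For x = 0 every state lies in \<open>Omega\<close> and both sides vanish; a
      nonzero element supplies a state.\<close>
    obtain a :: 'a where "a \<noteq> 0"
      using assms by blast
    from state_of_directional_derivative[OF this star_b]
    obtain \<phi> where \<phi>: "\<phi> \<in> states sm star" .
    have zero: "ip z 0 = 0" "ip 0 z = 0" for z
      using ip_scaleR_right[of z 0 0] ip_scaleR_left[of 0 0 z] by simp_all
    have "bounded_linear \<phi>"
      using \<phi> by (simp add: states_def)
    then have "\<phi> 0 = 0"
      by (rule linear_0[OF bounded_linear.linear])
    then show ?thesis
      using \<phi> by (intro bexI[of _ \<phi>]) (simp_all add: True zero)
  next
    case False
    obtain d where d: "ip x x = star d * d"
      using cstar_positive_ip by (auto simp: cstar_positive_def)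
    then have "d \<noteq> 0"
      using False ip_self_eq_0[of x] by auto
    from state_of_directional_derivative[OF this star_b] show ?thesis
      unfolding d by blast
  qed
  then obtain \<phi> where \<phi>: "\<phi> \<in> states sm star" "\<phi> (ip x x) = complex_of_real (norm (ip x x))"
    "((\<lambda>t. (norm (ip x x + t *\<^sub>R ?b) - norm (ip x x)) / t) \<longlongrightarrow> Re (\<phi> ?b)) (at_right 0)"
    by blast
  \<comment> \<open>Both summands of b have the same real part under a state.\<close>
  have eq: "Re (\<phi> ?b) / 2 = Re (\<phi> (ip x y))"
    using \<phi>(1) state_ip_commute[OF \<phi>(1), of y x] by (simp add: states_def)
  have "\<phi> \<in> Omega sm star ip x"
    using \<phi>(1,2) by (simp add: Omega_def norm_ip_self)
  then show ?thesis
    using norm_derivative_tendsto[OF \<phi>(3)] unfolding eq by (rule that)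
qed

end

text \<open>Existence of the limit is part of the claim. The second assumption excludes the zero
  algebra, which carries no functional of norm one and hence no state.\<close>

theorem theorem2p3:
  fixes sm :: "complex \<Rightarrow> 'a::{real_normed_algebra,banach} \<Rightarrow> 'a"
    and star :: "'a \<Rightarrow> 'a"
    and smx :: "complex \<Rightarrow> 'x::banach \<Rightarrow> 'x"
    and act :: "'x \<Rightarrow> 'a \<Rightarrow> 'x"
    and ip :: "'x \<Rightarrow> 'x \<Rightarrow> 'a"
    and x y :: 'x
  assumes "hilbert_module sm star smx act ip"
    and "\<exists>a::'a. a \<noteq> 0"
  shows "\<exists>\<phi>\<in>Omega sm star ip x.
           (\<forall>\<psi>\<in>Omega sm star ip x. Re (\<psi> (ip x y)) \<le> Re (\<phi> (ip x y))) \<and>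
           ((\<lambda>t. ((norm (x + t *\<^sub>R y))\<^sup>2 - (norm x)\<^sup>2) / (2 * t))
              \<longlongrightarrow> Re (\<phi> (ip x y))) (at_right 0)"
proof -
  interpret hilbert_cstar_module sm star smx act ip
    using assms(1) by unfold_locales
  obtain \<phi> where \<phi>: "\<phi> \<in> Omega sm star ip x"
    "((\<lambda>t. ((norm (x + t *\<^sub>R y))\<^sup>2 - (norm x)\<^sup>2) / (2 * t)) \<longlongrightarrow> Re (\<phi> (ip x y))) (at_right 0)"
    by (rule Omega_attains_norm_derivative[OF assms(2)])
  then show ?thesis
    using Omega_le_norm_derivative[OF _ \<phi>(2)] by (intro bexI[of _ \<phi>] conjI ballI)
qed

end
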